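(* Let $(W_i)_{i\in I}$ be a family of finite-dimensional $\mathbb{F}_p$-vector spaces. 1. Let $\mathcal{G}$ be a groupoid whose set of objects is the disjoint union of the sets of subspaces of the $W_i$, whose morphisms are isomorphisms of vector spaces, and which has the restriction property. Let $q$ be the canonical surjection from $\bigsqcup_{i\in I}\mathrm{Hom}_{\mathcal{VI}}(\_,W_i)$ to $\bigsqcup_{i\in I}\mathrm{Hom}_{\mathcal{VI}}(\_,W_i)/\sim_{\mathcal{G}}$. Then $$\mathcal{G}_{\left(\bigsqcup_{i\in I}\mathrm{Hom}_{\mathcal{VI}}(\_,W_i)/\sim_{\mathcal{G}},\ q\right)}=\mathcal{G}.$$ 2. Conversely, let $(F,q_F)$ be an object of ${}_{(W_i)_{i\in I}}\mathcal{S}et^{(\mathcal{VI})^{\mathrm{op}}}$, and let $\mathcal{G}_F=\mathcal{G}_{(F,q_F)}$. Then, in this category, $F$ is isomorphic to $\bigsqcup_{i\in I}\mathrm{Hom}_{\mathcal{VI}}(\_,W_i)/\sim_{\mathcal{G}_F}$ (equipped with its canonical surjection).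
   Context: $\mathcal{VI}$ is the category of finite-dimensional $\mathbb{F}_p$-vector spaces and injective linear maps; $\mathcal{S}et^{(\mathcal{VI})^{\mathrm{op}}}$ is the category of contravariant functors from $\mathcal{VI}$ to sets, and we write $\alpha^*=F(\alpha)$. ${}_{(W_i)_{i\in I}}\mathcal{S}et^{(\mathcal{VI})^{\mathrm{op}}}$ is the category whose objects are pairs $(F,q_F)$ with $F\in\mathcal{S}et^{(\mathcal{VI})^{\mathrm{op}}}$ and $q_F:\bigsqcup_{i\in I}\mathrm{Hom}_{\mathcal{VI}}(\_,W_i)\to F$ a natural surjection, and whose morphisms $(F,q_F)\to(G,q_G)$ are natural transformations $\eta:F\to G$ with $\eta\circ q_F=q_G$. For such a pair, $\phi_i\in F(W_i)$ denotes $q_F(\mathrm{id}_{W_i})$. $\mathcal{G}_{(F,q_F)}$ is the groupoid whose set of objects is the disjoint union over $i\in I$ of the sets of subspaces of $W_i$ (an object is written $U\subset W_i$), and whose morphisms from $U\subset W_i$ to $U'\subset W_j$ are the linear isomorphisms $\alpha:U\to U'$ such that $\alpha^*\iota_{U'}^*\phi_j=\iota_U^*\phi_i$, where $\iota_U:U\to W_i$, $\iota_{U'}:U'\to W_j$ are the inclusions. A groupoid $\mathcal{G}$ with that set of objects, whose morphisms are linear isomorphisms, has the restriction property if for all $U\subset W_i$, $U'\subset W_j$, $\alpha\in\mathcal{G}(U\subset W_i,U'\subset W_j)$ and every subspace $M\subset U$, the restriction $\alpha_M:M\to\alpha(M)$ is in $\mathcal{G}(M\subset W_i,\alpha(M)\subset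 W_j)$. (Each $\mathcal{G}_{(F,q_F)}$ has this property.) For $\mathcal{G}$ with the restriction property, $\sim_{\mathcal{G}}$ is the equivalence relation on $\bigsqcup_{i\in I}\mathrm{Hom}_{\mathcal{VI}}(V,W_i)$ defined by: for $\zeta:V\to W_i$ and $\epsilon:V\to W_j$, $\zeta\sim_{\mathcal{G}}\epsilon$ if there is $\alpha\in\mathcal{G}(\mathrm{Im}(\zeta)\subset W_i,\mathrm{Im}(\epsilon)\subset W_j)$ with $\tilde\epsilon=\alpha\circ\tilde\zeta$, where $\tilde\zeta,\tilde\epsilon$ are the corestrictions of $\zeta,\epsilon$ to their images. The quotient is a contravariant functor on $\mathcal{VI}$. *)

theory Defs
  imports
    "Jordan_Normal_Form.Missing_VectorSpace"
    "HOL-Number_Theory.Residues"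
begin

section \<open>The category of finite-dimensional spaces over the prime field and injective linear maps\<close>

abbreviation Fp :: "nat \<Rightarrow> int ring" where
  "Fp p \<equiv> residue_ring (int p)"

text \<open>The vectors of all spaces live in one type \<open>'v\<close>, which is an arbitrary parameter.\<close>

type_synonym 'v space = "(int, 'v) module"

definition VI_obj :: "nat \<Rightarrow> 'v space \<Rightarrow> bool" where
  "VI_obj p V \<longleftrightarrow> vectorspace (Fp p) V \<and> vectorspace.fin_dim (Fp p) V"

text \<open>Maps between carriers are represented extensionally (\<open>undefined\<close> outside the source), so
  that equality of HOL functions is equality of maps with a given source and target. In particular
  a map and its corestriction to its image are the same HOL function.\<close>

definition VI_hom :: "nat \<Rightarrow> 'v space \<Rightarrow> 'v space \<Rightarrow> ('v \<Rightarrow> 'v) set" where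
  "VI_hom p V W =
    {f \<in> extensional (carrier V). linear_map (Fp p) V W f \<and> inj_on f (carrier V)}"

definition lin_iso :: "nat \<Rightarrow> 'v space \<Rightarrow> 'v space \<Rightarrow> ('v \<Rightarrow> 'v) set" where
  "lin_iso p V W =
    {f \<in> extensional (carrier V). linear_map (Fp p) V W f \<and> bij_betw f (carrier V) (carrier W)}"

abbreviation id_map :: "'v set \<Rightarrow> 'v \<Rightarrow> 'v" where
  "id_map A \<equiv> (\<lambda>x\<in>A. x)"

section \<open>Contravariant functors to sets and natural transformations\<close>

text \<open>For \<open>\<alpha> : V \<rightarrow> W\<close> the induced map \<open>\<alpha>\<^sup>* : F(W) \<rightarrow> F(V)\<close> is \<open>pull F V W \<alpha>\<close>; source and target
  are explicit because the HOL function \<open>\<alpha>\<close> does not determine them. Values of \<open>ob F\<close>, \<open>pull F\<close>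
  and of natural transformations outside their proper domains are irrelevant.\<close>

record ('v, 's) presheaf =
  ob :: "'v space \<Rightarrow> 's set"
  pull :: "'v space \<Rightarrow> 'v space \<Rightarrow> ('v \<Rightarrow> 'v) \<Rightarrow> 's \<Rightarrow> 's"

definition is_presheaf :: "nat \<Rightarrow> ('v, 's) presheaf \<Rightarrow> bool" where
  "is_presheaf p F \<longleftrightarrow>
    (\<forall>V W. VI_obj p V \<longrightarrow> VI_obj p W \<longrightarrow>
      (\<forall>\<alpha>\<in>VI_hom p V W. \<forall>x\<in>ob F W. pull F V W \<alpha> x \<in> ob F V)) \<and>
    (\<forall>V. VI_obj p V \<longrightarrow> (\<forall>x\<in>ob F V. pull F V V (id_map (carrier V)) x = x)) \<and>
    (\<forall>U V W. VI_obj p U \<longrightarrow> VI_obj p V \<longrightarrow> VI_obj p W \<longrightarrow>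
      (\<forall>\<alpha>\<in>VI_hom p U V. \<forall>\<beta>\<in>VI_hom p V W. \<forall>x\<in>ob F W.
        pull F U W (compose (carrier U) \<beta> \<alpha>) x = pull F U V \<alpha> (pull F V W \<beta> x)))"

definition nat_trans ::
  "nat \<Rightarrow> ('v, 's) presheaf \<Rightarrow> ('v, 't) presheaf \<Rightarrow> ('v space \<Rightarrow> 's \<Rightarrow> 't) \<Rightarrow> bool" where
  "nat_trans p F G \<eta> \<longleftrightarrow>
    (\<forall>V. VI_obj p V \<longrightarrow> (\<forall>x\<in>ob F V. \<eta> V x \<in> ob G V)) \<and>
    (\<forall>V W. VI_obj p V \<longrightarrow> VI_obj p W \<longrightarrow>
      (\<forall>\<alpha>\<in>VI_hom p V W. \<forall>x\<in>ob F W. \<eta> V (pull F V W \<alpha> x) = pull G V W \<alpha> (\<eta> W x)))"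

text \<open>The functor \<open>\<Squnion>\<^sub>i Hom(_, W\<^sub>i)\<close>; the element \<open>\<zeta> : V \<rightarrow> W\<^sub>i\<close> of the \<open>i\<close>-th summand is \<open>(i, \<zeta>)\<close>.\<close>

definition hom_sum ::
  "nat \<Rightarrow> 'i set \<Rightarrow> ('i \<Rightarrow> 'v space) \<Rightarrow> ('v, 'i \<times> ('v \<Rightarrow> 'v)) presheaf" where
  "hom_sum p I W =
    \<lparr>ob = (\<lambda>V. SIGMA i:I. VI_hom p V (W i)),
     pull = (\<lambda>U V \<alpha> (i, \<zeta>). (i, compose (carrier U) \<zeta> \<alpha>))\<rparr>"

section \<open>The category of functors under the sum of representables\<close>

definition under_obj :: "nat \<Rightarrow> 'i set \<Rightarrow> ('i \<Rightarrow> 'v space) \<Rightarrow> ('v, 's) presheaf \<Rightarrow>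
    ('v space \<Rightarrow> 'i \<times> ('v \<Rightarrow> 'v) \<Rightarrow> 's) \<Rightarrow> bool" where
  "under_obj p I W F q \<longleftrightarrow>
    is_presheaf p F \<and> nat_trans p (hom_sum p I W) F q \<and>
    (\<forall>V. VI_obj p V \<longrightarrow> q V ` ob (hom_sum p I W) V = ob F V)"

definition under_mor :: "nat \<Rightarrow> 'i set \<Rightarrow> ('i \<Rightarrow> 'v space) \<Rightarrow>
    ('v, 's) presheaf \<Rightarrow> ('v space \<Rightarrow> 'i \<times> ('v \<Rightarrow> 'v) \<Rightarrow> 's) \<Rightarrow>
    ('v, 't) presheaf \<Rightarrow> ('v space \<Rightarrow> 'i \<times> ('v \<Rightarrow> 'v) \<Rightarrow> 't) \<Rightarrow>
    ('v space \<Rightarrow> 's \<Rightarrow> 't) \<Rightarrow> bool" where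
  "under_mor p I W F qF G qG \<eta> \<longleftrightarrow>
    nat_trans p F G \<eta> \<and>
    (\<forall>V. VI_obj p V \<longrightarrow> (\<forall>z\<in>ob (hom_sum p I W) V. \<eta> V (qF V z) = qG V z))"

definition under_isomorphic :: "nat \<Rightarrow> 'i set \<Rightarrow> ('i \<Rightarrow> 'v space) \<Rightarrow>
    ('v, 's) presheaf \<Rightarrow> ('v space \<Rightarrow> 'i \<times> ('v \<Rightarrow> 'v) \<Rightarrow> 's) \<Rightarrow>
    ('v, 't) presheaf \<Rightarrow> ('v space \<Rightarrow> 'i \<times> ('v \<Rightarrow> 'v) \<Rightarrow> 't) \<Rightarrow> bool" where
  "under_isomorphic p I W F qF G qG \<longleftrightarrow>
    under_obj p I W F qF \<and> under_obj p I W G qG \<and>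
    (\<exists>\<eta> \<theta>. under_mor p I W F qF G qG \<eta> \<and> under_mor p I W G qG F qF \<theta> \<and>
      (\<forall>V. VI_obj p V \<longrightarrow>
        (\<forall>x\<in>ob F V. \<theta> V (\<eta> V x) = x) \<and> (\<forall>y\<in>ob G V. \<eta> V (\<theta> V y) = y)))"

section \<open>Groupoids of isomorphisms between subspaces\<close>

text \<open>The object \<open>U \<subseteq> W\<^sub>i\<close> is the pair \<open>(i, U)\<close>. As the objects are fixed by the family \<open>W\<close>, a
  groupoid is given by its family of hom-sets, taken to be empty outside the objects so that
  equality of such families is equality of groupoids.\<close>

definition gpd_obj :: "nat \<Rightarrow> 'i set \<Rightarrow> ('i \<Rightarrow> 'v space) \<Rightarrow> ('i \<times> 'v set) set" where
  "gpd_obj p I W = (SIGMA i:I. {U. VectorSpace.subspace (Fp p) U (W i)})"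

definition as_space :: "('i \<Rightarrow> 'v space) \<Rightarrow> 'i \<times> 'v set \<Rightarrow> 'v space" where
  "as_space W x = (W (fst x))\<lparr>carrier := snd x\<rparr>"

type_synonym ('i, 'v) gpd = "'i \<times> 'v set \<Rightarrow> 'i \<times> 'v set \<Rightarrow> ('v \<Rightarrow> 'v) set"

definition is_groupoid :: "nat \<Rightarrow> 'i set \<Rightarrow> ('i \<Rightarrow> 'v space) \<Rightarrow> ('i, 'v) gpd \<Rightarrow> bool" where
  "is_groupoid p I W \<G> \<longleftrightarrow>
    (\<forall>x y. \<not> (x \<in> gpd_obj p I W \<and> y \<in> gpd_obj p I W) \<longrightarrow> \<G> x y = {}) \<and>
    (\<forall>x\<in>gpd_obj p I W. \<forall>y\<in>gpd_obj p I W. \<G> x y \<subseteq> lin_iso p (as_space W x) (as_space W y)) \<and>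
    (\<forall>x\<in>gpd_obj p I W. id_map (snd x) \<in> \<G> x x) \<and>
    (\<forall>x\<in>gpd_obj p I W. \<forall>y\<in>gpd_obj p I W. \<forall>z\<in>gpd_obj p I W.
      \<forall>\<alpha>\<in>\<G> x y. \<forall>\<beta>\<in>\<G> y z. compose (snd x) \<beta> \<alpha> \<in> \<G> x z) \<and>
    (\<forall>x\<in>gpd_obj p I W. \<forall>y\<in>gpd_obj p I W.
      \<forall>\<alpha>\<in>\<G> x y. restrict (inv_into (snd x) \<alpha>) (snd y) \<in> \<G> y x)"

definition restriction_property ::
  "nat \<Rightarrow> 'i set \<Rightarrow> ('i \<Rightarrow> 'v space) \<Rightarrow> ('i, 'v) gpd \<Rightarrow> bool" where
  "restriction_property p I W \<G> \<longleftrightarrow>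
    (\<forall>(i, U)\<in>gpd_obj p I W. \<forall>(j, U')\<in>gpd_obj p I W. \<forall>\<alpha>\<in>\<G> (i, U) (j, U').
      \<forall>M. VectorSpace.subspace (Fp p) M (W i) \<and> M \<subseteq> U \<longrightarrow>
        restrict \<alpha> M \<in> \<G> (i, M) (j, \<alpha> ` M))"

text \<open>The element \<open>\<iota>\<^sub>U\<^sup>* \<phi>\<^sub>i\<close> of \<open>F(U)\<close>, where \<open>\<phi>\<^sub>i = q(id)\<close>.\<close>

definition restricted_elt :: "('i \<Rightarrow> 'v space) \<Rightarrow> ('v, 's) presheaf \<Rightarrow>
    ('v space \<Rightarrow> 'i \<times> ('v \<Rightarrow> 'v) \<Rightarrow> 's) \<Rightarrow> 'i \<times> 'v set \<Rightarrow> 's" where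
  "restricted_elt W F q x = (case x of (i, U) \<Rightarrow>
    pull F (as_space W (i, U)) (W i) (id_map U) (q (W i) (i, id_map (carrier (W i)))))"

definition gpd_of :: "nat \<Rightarrow> 'i set \<Rightarrow> ('i \<Rightarrow> 'v space) \<Rightarrow> ('v, 's) presheaf \<Rightarrow>
    ('v space \<Rightarrow> 'i \<times> ('v \<Rightarrow> 'v) \<Rightarrow> 's) \<Rightarrow> ('i, 'v) gpd" where
  "gpd_of p I W F q x y =
    {\<alpha>. x \<in> gpd_obj p I W \<and> y \<in> gpd_obj p I W \<and>
        \<alpha> \<in> lin_iso p (as_space W x) (as_space W y) \<and>
        pull F (as_space W x) (as_space W y) \<alpha> (restricted_elt W F q y) = restricted_elt W F q x}"

section \<open>The quotient of the sum of representables by a groupoid\<close>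

definition gpd_rel :: "nat \<Rightarrow> 'i set \<Rightarrow> ('i \<Rightarrow> 'v space) \<Rightarrow> ('i, 'v) gpd \<Rightarrow> 'v space \<Rightarrow>
    (('i \<times> ('v \<Rightarrow> 'v)) \<times> ('i \<times> ('v \<Rightarrow> 'v))) set" where
  "gpd_rel p I W \<G> V =
    {((i, \<zeta>), (j, \<epsilon>)).
      (i, \<zeta>) \<in> ob (hom_sum p I W) V \<and> (j, \<epsilon>) \<in> ob (hom_sum p I W) V \<and>
      (\<exists>\<alpha>\<in>\<G> (i, \<zeta> ` carrier V) (j, \<epsilon> ` carrier V). \<epsilon> = compose (carrier V) \<alpha> \<zeta>)}"

text \<open>The map induced by \<open>\<alpha> : U \<rightarrow> V\<close> sends the class \<open>X\<close> of \<open>(i, \<zeta>)\<close> to the class of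
  \<open>(i, \<zeta> \<circ> \<alpha>)\<close>, written without choosing a representative.\<close>

definition quot :: "nat \<Rightarrow> 'i set \<Rightarrow> ('i \<Rightarrow> 'v space) \<Rightarrow> ('i, 'v) gpd \<Rightarrow>
    ('v, ('i \<times> ('v \<Rightarrow> 'v)) set) presheaf" where
  "quot p I W \<G> =
    \<lparr>ob = (\<lambda>V. ob (hom_sum p I W) V // gpd_rel p I W \<G> V),
     pull = (\<lambda>U V \<alpha> X. gpd_rel p I W \<G> U `` (pull (hom_sum p I W) U V \<alpha> ` X))\<rparr>"

definition quot_map :: "nat \<Rightarrow> 'i set \<Rightarrow> ('i \<Rightarrow> 'v space) \<Rightarrow> ('i, 'v) gpd \<Rightarrow>
    'v space \<Rightarrow> 'i \<times> ('v \<Rightarrow> 'v) \<Rightarrow> ('i \<times> ('v \<Rightarrow> 'v)) set" where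
  "quot_map p I W \<G> V z = gpd_rel p I W \<G> V `` {z}"

end

theory Submission
  imports Defs
begin

text \<open>
  An object \<open>(F, q)\<close> under \<open>\<Squnion>\<^sub>i Hom(_, W\<^sub>i)\<close> is determined up to unique isomorphism by the kernel
  of its surjection \<open>q\<close>, that is, by the relations \<open>q\<^sub>V(\<zeta>) = q\<^sub>V(\<epsilon>)\<close> on the sets
  \<open>\<Squnion>\<^sub>i Hom(V, W\<^sub>i)\<close>; conversely every family of equivalence relations that is stable under
  precomposition is such a kernel (\<open>under_isomorphic_if_kernel_eq\<close>, \<open>under_obj_quot\<close>).
  The theorem therefore compares kernels with groupoids.

  The bridge is \<open>gpd_of_iff\<close>. By naturality, \<open>\<iota>\<^sub>U\<^sup>* \<phi>\<^sub>i\<close> is the value of \<open>q\<close> at the inclusion \<open>U \<rightarrow> W\<^sub>i\<close>,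
  and \<open>\<alpha>\<^sup>* \<iota>\<^sub>U\<^sub>'\<^sup>* \<phi>\<^sub>j\<close> is the value of \<open>q\<close> at \<open>\<alpha>\<close> seen as a map \<open>U \<rightarrow> W\<^sub>j\<close>. So an isomorphism
  \<open>\<alpha> : U \<rightarrow> U'\<close> is a morphism of the groupoid of \<open>(F, q)\<close> if and only if \<open>q\<close> identifies \<open>\<alpha>\<close> with
  the inclusion of \<open>U\<close>: the groupoid records the part of the kernel in which one of the two maps is
  an inclusion.

  Nothing is lost by this. A general pair \<open>\<zeta> : V \<rightarrow> W\<^sub>i\<close>, \<open>\<epsilon> : V \<rightarrow> W\<^sub>j\<close> becomes the pair
  \<open>(\<iota>, \<epsilon> \<circ> \<zeta>\<^sup>-\<^sup>1)\<close> on the image of \<open>\<zeta>\<close> when it is transported along the isomorphism \<open>V \<rightarrow> Im \<zeta>\<close>.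
  Hence \<open>\<sim>\<close> for the groupoid of \<open>(F, q)\<close> is exactly the kernel of \<open>q\<close> (\<open>gpd_rel_gpd_of_iff\<close>), which
  gives the second part. For the first part, the groupoid axioms make \<open>\<sim>\<close> an equivalence relation,
  the restriction property makes it stable under precomposition, and \<open>\<alpha>\<close> is equivalent to the
  inclusion of \<open>U\<close> only through \<open>\<alpha>\<close> itself, so that the bridge returns \<open>\<G>\<close> (\<open>gpd_of_quot\<close>).
\<close>

section \<open>Linear algebra over the prime field\<close>

lemma linear_map_iff:
  "linear_map K V W f \<longleftrightarrow> vectorspace K V \<and> vectorspace K W \<and> f \<in> carrier V \<rightarrow> carrier W \<and>
    (\<forall>x\<in>carrier V. \<forall>y\<in>carrier V. f (x \<oplus>\<^bsub>V\<^esub> y) = f x \<oplus>\<^bsub>W\<^esub> f y) \<and>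
    (\<forall>r\<in>carrier K. \<forall>x\<in>carrier V. f (r \<odot>\<^bsub>V\<^esub> x) = r \<odot>\<^bsub>W\<^esub> f x)"
  unfolding linear_map_def mod_hom_def mod_hom_axioms_def LinearCombinations.module_hom_def vectorspace_def
  by auto

lemma VI_obj_vectorspace: "VI_obj p V \<Longrightarrow> vectorspace (Fp p) V"
  by (simp add: VI_obj_def)

lemma finite_carrier_of_VI_obj:
  assumes "VI_obj p V"
  shows "finite (carrier V)"
proof -
  interpret V: vectorspace "Fp p" V
    by (rule VI_obj_vectorspace[OF assms])
  obtain A where A: "finite A" "A \<subseteq> carrier V" "V.span A = carrier V"
    using assms by (auto simp: VI_obj_def V.fin_dim_def)
  have "V.span A \<subseteq> (\<lambda>a. V.lincomb a A) ` (A \<rightarrow>\<^sub>E carrier (Fp p))"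
  proof
    fix v assume "v \<in> V.span A"
    then obtain a where a: "a \<in> A \<rightarrow> carrier (Fp p)" "v = V.lincomb a A"
      using V.finite_span[OF A(1,2)] by auto
    have "V.lincomb a A = V.lincomb (restrict a A) A"
      using a A by (intro V.lincomb_cong) auto
    then show "v \<in> (\<lambda>a. V.lincomb a A) ` (A \<rightarrow>\<^sub>E carrier (Fp p))"
      using a by (intro image_eqI[of _ _ "restrict a A"]) auto
  qed
  moreover have "finite (A \<rightarrow>\<^sub>E carrier (Fp p))"
    using A(1) by (intro finite_PiE) (simp_all add: residue_ring_def)
  ultimately show ?thesis
    using A(3) finite_surj by metis
qed

text \<open>The base field is finite, so finite-dimensional spaces are finite sets, and a finite space is
  spanned by all of its elements.\<close>

lemma VI_obj_subspace:
  assumes "VI_obj p V" and "VectorSpace.subspace (Fp p) U V"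
  shows "VI_obj p (V\<lparr>carrier := U\<rparr>)"
proof -
  interpret V: vectorspace "Fp p" V
    by (rule VI_obj_vectorspace[OF assms(1)])
  interpret U: vectorspace "Fp p" "V\<lparr>carrier := U\<rparr>"
    by (rule V.subspace_is_vs[OF assms(2)])
  have "U \<subseteq> carrier V"
    using assms(2) by (simp add: VectorSpace.subspace_def submodule_def)
  then have "finite U"
    using finite_carrier_of_VI_obj[OF assms(1)] finite_subset by blast
  moreover have "U.span U = U"
    using U.in_own_span[of U] U.span_is_subset2[of U] by auto
  ultimately have "U.fin_dim"
    unfolding U.fin_dim_def by (intro exI[of _ U]) auto
  then show ?thesis
    using U.vectorspace_axioms by (simp add: VI_obj_def)
qed

lemma VI_homD:
  assumes "f \<in> VI_hom p V W"
  shows "f \<in> extensional (carrier V)" "f ` carrier V \<subseteq> carrier W" "inj_on f (carrier V)"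
    "\<And>x. x \<in> carrier V \<Longrightarrow> f x \<in> carrier W"
  using assms by (auto simp: VI_hom_def linear_map_iff)

lemma VI_hom_compose:
  assumes "f \<in> VI_hom p U V" and "g \<in> VI_hom p V W"
  shows "compose (carrier U) g f \<in> VI_hom p U W"
proof -
  interpret f: linear_map "Fp p" U V f
    using assms(1) by (simp add: VI_hom_def)
  have "inj_on (compose (carrier U) g f) (carrier U)"
    using VI_homD(3,4)[OF assms(1)] VI_homD(3)[OF assms(2)]
    by (auto simp: inj_on_def compose_def)
  moreover have "linear_map (Fp p) U W (compose (carrier U) g f)"
    using assms f.V.module.M.a_closed f.V.module.smult_closed unfolding VI_hom_def
    by (auto simp: linear_map_iff compose_def Pi_iff)
  ultimately show ?thesis
    by (simp add: VI_hom_def)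
qed

lemma VI_hom_subspace_inclusion:
  assumes "vectorspace (Fp p) V" and "VectorSpace.subspace (Fp p) U V"
  shows "id_map U \<in> VI_hom p (V\<lparr>carrier := U\<rparr>) V"
proof -
  interpret V: vectorspace "Fp p" V
    by (rule assms(1))
  show ?thesis
    using assms V.subspace_is_vs[OF assms(2)]
    by (auto simp: VI_hom_def linear_map_iff VectorSpace.subspace_def submodule_def inj_on_def)
qed

lemma VI_hom_id:
  assumes "vectorspace (Fp p) V"
  shows "id_map (carrier V) \<in> VI_hom p V V"
proof -
  interpret V: vectorspace "Fp p" V
    by (rule assms)
  show ?thesis
    using assms by (auto simp: VI_hom_def linear_map_iff inj_on_def)
qed

lemma compose_id_map:
  assumes "f \<in> VI_hom p V W"
  shows "compose (carrier V) (id_map (carrier W)) f = f"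
  using VI_homD(1,4)[OF assms] by (auto simp: compose_def fun_eq_iff extensional_def)

lemma subspace_image_VI_hom:
  assumes "f \<in> VI_hom p V W"
  shows "VectorSpace.subspace (Fp p) (f ` carrier V) W"
proof -
  interpret f: linear_map "Fp p" V W f
    using assms by (simp add: VI_hom_def)
  show ?thesis
    using f.imT_is_subspace by (simp add: f.im_def)
qed

text \<open>A map and its corestriction are the same function, so an injective map already is the
  isomorphism \<open>V \<rightarrow> Im f\<close>.\<close>

lemma lin_iso_corestriction:
  assumes "f \<in> VI_hom p V W"
  shows "f \<in> lin_iso p V (W\<lparr>carrier := f ` carrier V\<rparr>)"
proof -
  interpret f: linear_map "Fp p" V W f
    using assms by (simp add: VI_hom_def)
  show ?thesis
    using assms f.W.subspace_is_vs[OF subspace_image_VI_hom[OF assms]]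
    by (auto simp: VI_hom_def lin_iso_def linear_map_iff bij_betw_def)
qed

lemma lin_iso_subset_VI_hom: "lin_iso p V W \<subseteq> VI_hom p V W"
  by (auto simp: lin_iso_def VI_hom_def bij_betw_def)

lemma lin_iso_inverse:
  assumes "f \<in> lin_iso p V W"
  shows "restrict (inv_into (carrier V) f) (carrier W) \<in> lin_iso p W V"
proof -
  let ?g = "inv_into (carrier V) f"
  interpret f: linear_map "Fp p" V W f
    using assms by (simp add: lin_iso_def)
  have bij: "bij_betw f (carrier V) (carrier W)"
    using assms by (simp add: lin_iso_def)
  then have inj: "inj_on f (carrier V)" and g: "\<And>y. y \<in> carrier W \<Longrightarrow> ?g y \<in> carrier V"
    "\<And>y. y \<in> carrier W \<Longrightarrow> f (?g y) = y"
    by (auto simp: bij_betw_def f_inv_into_f inv_into_into)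
  have "?g (x \<oplus>\<^bsub>W\<^esub> y) = ?g x \<oplus>\<^bsub>V\<^esub> ?g y" if "x \<in> carrier W" "y \<in> carrier W" for x y
    using that g by (intro inv_into_f_eq[OF inj]) auto
  moreover have "?g (r \<odot>\<^bsub>W\<^esub> x) = r \<odot>\<^bsub>V\<^esub> ?g x" if "r \<in> carrier (Fp p)" "x \<in> carrier W" for r x
    using that g by (intro inv_into_f_eq[OF inj]) auto
  moreover have "bij_betw (restrict ?g (carrier W)) (carrier W) (carrier V)"
    using bij_betw_inv_into[OF bij] by (simp add: bij_betw_def cong: inj_on_cong image_cong_simp)
  ultimately show ?thesis
    using f.V.vectorspace_axioms f.W.vectorspace_axioms g
    by (auto simp: lin_iso_def linear_map_iff)
qed

section \<open>Objects under a sum of representables\<close>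

lemma mem_hom_sum: "(i, \<zeta>) \<in> ob (hom_sum p I W) V \<longleftrightarrow> i \<in> I \<and> \<zeta> \<in> VI_hom p V (W i)"
  by (simp add: hom_sum_def)

lemma pull_hom_sum: "pull (hom_sum p I W) U V \<alpha> (i, \<zeta>) = (i, compose (carrier U) \<zeta> \<alpha>)"
  by (simp add: hom_sum_def)

lemma pull_hom_sum_closed:
  assumes "\<alpha> \<in> VI_hom p U V" and "z \<in> ob (hom_sum p I W) V"
  shows "pull (hom_sum p I W) U V \<alpha> z \<in> ob (hom_sum p I W) U"
  using assms by (cases z) (simp add: mem_hom_sum pull_hom_sum VI_hom_compose)

lemma pull_hom_sum_id:
  assumes "z \<in> ob (hom_sum p I W) V"
  shows "pull (hom_sum p I W) V V (id_map (carrier V)) z = z"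
proof (cases z)
  case (Pair i \<zeta>)
  with assms have "\<zeta> \<in> extensional (carrier V)"
    by (auto simp: mem_hom_sum dest: VI_homD(1))
  then show ?thesis
    by (auto simp: Pair pull_hom_sum compose_def fun_eq_iff extensional_def)
qed

lemma pull_hom_sum_compose:
  assumes "\<alpha> \<in> VI_hom p U V"
  shows "pull (hom_sum p I W) U X (compose (carrier U) \<beta> \<alpha>) z =
    pull (hom_sum p I W) U V \<alpha> (pull (hom_sum p I W) V X \<beta> z)"
  using VI_homD(4)[OF assms]
  by (cases z) (auto simp: pull_hom_sum compose_def fun_eq_iff)

lemma under_obj_pull:
  assumes "under_obj p I W F q" and "VI_obj p U" and "VI_obj p V"
    and "\<alpha> \<in> VI_hom p U V" and "z \<in> ob (hom_sum p I W) V"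
  shows "q U (pull (hom_sum p I W) U V \<alpha> z) = pull F U V \<alpha> (q V z)"
proof -
  have "nat_trans p (hom_sum p I W) F q"
    using assms(1) by (simp add: under_obj_def)
  then show ?thesis
    using assms(2-) unfolding nat_trans_def by blast
qed

lemma under_obj_surj:
  assumes "under_obj p I W F q" and "VI_obj p V"
  shows "q V ` ob (hom_sum p I W) V = ob F V"
  using assms by (simp add: under_obj_def)

lemma under_obj_naturality:
  assumes "under_obj p I W F q" and "VI_obj p U" and "VI_obj p V"
    and "\<alpha> \<in> VI_hom p U V" and "i \<in> I" and "\<zeta> \<in> VI_hom p V (W i)"
  shows "q U (i, compose (carrier U) \<zeta> \<alpha>) = pull F U V \<alpha> (q V (i, \<zeta>))"
  using under_obj_pull[OF assms(1-4), of "(i, \<zeta>)"] assms(5,6)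
  by (simp add: mem_hom_sum pull_hom_sum)

text \<open>Since \<open>qF\<close> is surjective, \<open>qG\<close> descends along it as soon as it is constant on its fibres;
  the value at \<open>x\<close> is computed on a chosen preimage of \<open>x\<close>, and naturality is inherited from that
  of \<open>qF\<close> and \<open>qG\<close>.\<close>

lemma under_mor_if_kernel_le:
  assumes F: "under_obj p I W F qF" and G: "under_obj p I W G qG"
    and ker: "\<And>V z w. VI_obj p V \<Longrightarrow> z \<in> ob (hom_sum p I W) V \<Longrightarrow> w \<in> ob (hom_sum p I W) V \<Longrightarrow>
      qF V z = qF V w \<Longrightarrow> qG V z = qG V w"
  shows "\<exists>\<eta>. under_mor p I W F qF G qG \<eta>"
proof -
  let ?H = "hom_sum p I W"
  define \<eta> where "\<eta> = (\<lambda>V x. qG V (SOME z. z \<in> ob ?H V \<and> qF V z = x))"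
  have \<eta>: "\<eta> V (qF V z) = qG V z" if "VI_obj p V" "z \<in> ob ?H V" for V z
  proof -
    define w where "w = (SOME w. w \<in> ob ?H V \<and> qF V w = qF V z)"
    have "w \<in> ob ?H V \<and> qF V w = qF V z"
      unfolding w_def by (rule someI[of _ z]) (simp add: that)
    then have "qG V w = qG V z"
      using ker[OF that(1) _ that(2)] by blast
    then show ?thesis
      by (simp add: \<eta>_def w_def)
  qed
  have lift: "\<exists>z\<in>ob ?H V. x = qF V z" if "VI_obj p V" "x \<in> ob F V" for V x
    using under_obj_surj[OF F that(1)] that(2) by blast
  have "nat_trans p F G \<eta>"
    unfolding nat_trans_def
  proof (intro conjI allI impI ballI)
    fix V x assume V: "VI_obj p V" and x: "x \<in> ob F V"
    from lift[OF V x] obtain z where "z \<in> ob ?H V" "x = qF V z"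
      by blast
    then show "\<eta> V x \<in> ob G V"
      using \<eta>[OF V] under_obj_surj[OF G V] by auto
  next
    fix U V \<alpha> x
    assume UV: "VI_obj p U" "VI_obj p V" and \<alpha>: "\<alpha> \<in> VI_hom p U V" and x: "x \<in> ob F V"
    from lift[OF UV(2) x] obtain z where z: "z \<in> ob ?H V" "x = qF V z"
      by blast
    have "pull F U V \<alpha> x = qF U (pull ?H U V \<alpha> z)"
      using under_obj_pull[OF F UV \<alpha> z(1)] z(2) by simp
    then have "\<eta> U (pull F U V \<alpha> x) = qG U (pull ?H U V \<alpha> z)"
      using \<eta>[OF UV(1) pull_hom_sum_closed[OF \<alpha> z(1)]] by simp
    also have "\<dots> = pull G U V \<alpha> (qG V z)"
      by (rule under_obj_pull[OF G UV \<alpha> z(1)])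
    finally show "\<eta> U (pull F U V \<alpha> x) = pull G U V \<alpha> (\<eta> V x)"
      using \<eta>[OF UV(2) z(1)] z(2) by simp
  qed
  then show ?thesis
    unfolding under_mor_def using \<eta> by (intro exI[of _ \<eta>]) simp
qed

text \<open>The two induced morphisms are inverse to each other because every element is of the form
  \<open>qF V z\<close>, respectively \<open>qG V z\<close>, and the morphisms exchange \<open>qF V z\<close>
  and \<open>qG V z\<close>.\<close>

lemma under_isomorphic_if_kernel_eq:
  assumes F: "under_obj p I W F qF" and G: "under_obj p I W G qG"
    and ker: "\<And>V z w. VI_obj p V \<Longrightarrow> z \<in> ob (hom_sum p I W) V \<Longrightarrow> w \<in> ob (hom_sum p I W) V \<Longrightarrow>
      qF V z = qF V w \<longleftrightarrow> qG V z = qG V w"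
  shows "under_isomorphic p I W F qF G qG"
proof -
  obtain \<eta> where \<eta>: "under_mor p I W F qF G qG \<eta>"
    using under_mor_if_kernel_le[OF F G ker[THEN iffD1]] by blast
  obtain \<theta> where \<theta>: "under_mor p I W G qG F qF \<theta>"
    using under_mor_if_kernel_le[OF G F ker[THEN iffD2]] by blast
  have "\<theta> V (\<eta> V x) = x" if V: "VI_obj p V" and x: "x \<in> ob F V" for V x
  proof -
    obtain z where "z \<in> ob (hom_sum p I W) V" "x = qF V z"
      using under_obj_surj[OF F V] x by blast
    then show ?thesis
      using \<eta> \<theta> V unfolding under_mor_def by simp
  qed
  moreover have "\<eta> V (\<theta> V y) = y" if V: "VI_obj p V" and y: "y \<in> ob G V" for V y
  proof -
    obtain z where "z \<in> ob (hom_sum p I W) V" "y = qG V z"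
      using under_obj_surj[OF G V] y by blast
    then show ?thesis
      using \<eta> \<theta> V unfolding under_mor_def by simp
  qed
  ultimately show ?thesis
    unfolding under_isomorphic_def using F G \<eta> \<theta> by (intro conjI exI[of _ \<eta>] exI[of _ \<theta>]) auto
qed

section \<open>The quotient by a congruence\<close>

lemma quot_map_eq_iff:
  assumes "equiv (ob (hom_sum p I W) V) (gpd_rel p I W \<G> V)"
    and "z \<in> ob (hom_sum p I W) V" and "w \<in> ob (hom_sum p I W) V"
  shows "quot_map p I W \<G> V z = quot_map p I W \<G> V w \<longleftrightarrow> (z, w) \<in> gpd_rel p I W \<G> V"
  unfolding quot_map_def using assms by (simp add: eq_equiv_class_iff)

text \<open>Stability under precomposition gives \<open>\<alpha>\<^sup>*[z] = [z \<circ> \<alpha>]\<close> (\<open>pull_class\<close> in the proof). Through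
  this formula the functor laws and the naturality of \<open>quot_map\<close> are those of the sum of
  representables. The hypotheses are about the relation, so that the lemma applies both to the
  relation of a groupoid with the restriction property and to a kernel.\<close>

lemma under_obj_quot:
  assumes eqv: "\<And>V. VI_obj p V \<Longrightarrow> equiv (ob (hom_sum p I W) V) (gpd_rel p I W \<G> V)"
    and stable: "\<And>U V \<alpha> z w. VI_obj p U \<Longrightarrow> VI_obj p V \<Longrightarrow> \<alpha> \<in> VI_hom p U V \<Longrightarrow>
      (z, w) \<in> gpd_rel p I W \<G> V \<Longrightarrow>
      (pull (hom_sum p I W) U V \<alpha> z, pull (hom_sum p I W) U V \<alpha> w) \<in> gpd_rel p I W \<G> U"
  shows "under_obj p I W (quot p I W \<G>) (quot_map p I W \<G>)"
proof -
  let ?H = "hom_sum p I W" and ?Q = "quot p I W \<G>" and ?q = "quot_map p I W \<G>"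
    and ?R = "gpd_rel p I W \<G>"
  have surj: "?q V ` ob ?H V = ob ?Q V" for V
    by (auto simp: quot_def quot_map_def quotient_def)
  have pull_class: "pull ?Q U V \<alpha> (?q V z) = ?q U (pull ?H U V \<alpha> z)"
    if U: "VI_obj p U" and V: "VI_obj p V" and \<alpha>: "\<alpha> \<in> VI_hom p U V" and z: "z \<in> ob ?H V"
    for U V \<alpha> z
  proof -
    let ?f = "pull ?H U V \<alpha>" and ?X = "?R V `` {z}"
    have "pull ?Q U V \<alpha> (?q V z) = (\<Union>w\<in>?X. ?R U `` {?f w})"
      by (simp add: quot_def quot_map_def) blast
    also have "\<dots> = (\<Union>w\<in>?X. ?R U `` {?f z})"
    proof (intro SUP_cong refl)
      fix w assume "w \<in> ?X"
      then have "(z, w) \<in> ?R V"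
        by simp
      then show "?R U `` {?f w} = ?R U `` {?f z}"
        using equiv_class_eq[OF eqv[OF U] stable[OF U V \<alpha>]] by blast
    qed
    also have "\<dots> = ?q U (?f z)"
      using equiv_class_self[OF eqv[OF V] z] unfolding quot_map_def by blast
    finally show ?thesis .
  qed
  have lift: "\<exists>z\<in>ob ?H V. x = ?q V z" if "x \<in> ob ?Q V" for V x
    using that surj[of V] by blast
  have mem: "?q V z \<in> ob ?Q V" if "z \<in> ob ?H V" for V z
    using that surj[of V] by blast
  have "is_presheaf p ?Q"
    unfolding is_presheaf_def
  proof (intro conjI allI impI ballI)
    fix U V \<alpha> x
    assume UV: "VI_obj p U" "VI_obj p V" and \<alpha>: "\<alpha> \<in> VI_hom p U V" and "x \<in> ob ?Q V"
    then obtain z where z: "z \<in> ob ?H V" "x = ?q V z"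
      using lift by blast
    show "pull ?Q U V \<alpha> x \<in> ob ?Q U"
      unfolding z(2) pull_class[OF UV \<alpha> z(1)] by (rule mem[OF pull_hom_sum_closed[OF \<alpha> z(1)]])
  next
    fix V x assume V: "VI_obj p V" and "x \<in> ob ?Q V"
    then obtain z where z: "z \<in> ob ?H V" "x = ?q V z"
      using lift by blast
    show "pull ?Q V V (id_map (carrier V)) x = x"
      unfolding z(2) pull_class[OF V V VI_hom_id[OF VI_obj_vectorspace[OF V]] z(1)]
        pull_hom_sum_id[OF z(1)] by (rule refl)
  next
    fix U V X \<alpha> \<beta> x
    assume UVX: "VI_obj p U" "VI_obj p V" "VI_obj p X"
      and \<alpha>: "\<alpha> \<in> VI_hom p U V" and \<beta>: "\<beta> \<in> VI_hom p V X" and "x \<in> ob ?Q X"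
    then obtain z where z: "z \<in> ob ?H X" "x = ?q X z"
      using lift by blast
    have "pull ?Q U X (compose (carrier U) \<beta> \<alpha>) x
        = ?q U (pull ?H U X (compose (carrier U) \<beta> \<alpha>) z)"
      unfolding z(2) by (rule pull_class[OF UVX(1,3) VI_hom_compose[OF \<alpha> \<beta>] z(1)])
    also have "\<dots> = ?q U (pull ?H U V \<alpha> (pull ?H V X \<beta> z))"
      by (simp only: pull_hom_sum_compose[OF \<alpha>])
    also have "\<dots> = pull ?Q U V \<alpha> (pull ?Q V X \<beta> x)"
      unfolding z(2) pull_class[OF UVX(2,3) \<beta> z(1)]
      by (rule pull_class[OF UVX(1,2) \<alpha> pull_hom_sum_closed[OF \<beta> z(1)], symmetric])
    finally show "pull ?Q U X (compose (carrier U) \<beta> \<alpha>) x = pull ?Q U V \<alpha> (pull ?Q V X \<beta> x)" .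
  qed
  moreover have "nat_trans p ?H ?Q ?q"
    unfolding nat_trans_def
    by (intro conjI allI impI ballI mem pull_class[symmetric])
  ultimately show ?thesis
    unfolding under_obj_def by (intro conjI allI impI surj)
qed

section \<open>Morphisms of the groupoid of a quotient of representables\<close>

lemma carrier_as_space: "carrier (as_space W x) = snd x"
  by (simp add: as_space_def)

lemma as_space_VI:
  assumes W: "\<And>i. i \<in> I \<Longrightarrow> VI_obj p (W i)" and x: "x \<in> gpd_obj p I W"
  shows "VI_obj p (as_space W x)" and "id_map (snd x) \<in> VI_hom p (as_space W x) (W (fst x))"
proof -
  have "VI_obj p (W (fst x))" and "VectorSpace.subspace (Fp p) (snd x) (W (fst x))"
    using x W by (auto simp: gpd_obj_def)
  then show "VI_obj p (as_space W x)" and "id_map (snd x) \<in> VI_hom p (as_space W x) (W (fst x))"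
    unfolding as_space_def
    by (auto intro: VI_obj_subspace VI_hom_subspace_inclusion VI_obj_vectorspace)
qed

text \<open>Composition with the inclusion of a subspace does not change the underlying function.\<close>

lemma lin_iso_as_space_VI_hom:
  assumes W: "\<And>i. i \<in> I \<Longrightarrow> VI_obj p (W i)" and y: "y \<in> gpd_obj p I W"
    and \<alpha>: "\<alpha> \<in> lin_iso p V (as_space W y)"
  shows "\<alpha> \<in> VI_hom p V (W (fst y))"
proof -
  have hom: "\<alpha> \<in> VI_hom p V (as_space W y)"
    using \<alpha> lin_iso_subset_VI_hom by blast
  show ?thesis
    using VI_hom_compose[OF hom as_space_VI(2)[OF W y]] compose_id_map[OF hom]
    by (simp add: carrier_as_space)
qed

text \<open>Both sides of the equation that defines the groupoid of \<open>(F, q)\<close> are pullbacks of values of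
  \<open>q\<close>; naturality moves the pullbacks inside \<open>q\<close>.\<close>

lemma gpd_of_iff:
  assumes F: "under_obj p I W F q" and W: "\<And>i. i \<in> I \<Longrightarrow> VI_obj p (W i)"
    and x: "(i, U) \<in> gpd_obj p I W" and y: "(j, U') \<in> gpd_obj p I W"
  shows "\<alpha> \<in> gpd_of p I W F q (i, U) (j, U') \<longleftrightarrow>
    \<alpha> \<in> lin_iso p (as_space W (i, U)) (as_space W (j, U')) \<and>
    q (as_space W (i, U)) (j, \<alpha>) = q (as_space W (i, U)) (i, id_map U)"
proof -
  have elt: "restricted_elt W F q (k, M) = q (as_space W (k, M)) (k, id_map M)"
    if kM: "(k, M) \<in> gpd_obj p I W" for k M
  proof -
    have k: "k \<in> I"
      using kM by (simp add: gpd_obj_def)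
    have incl: "id_map M \<in> VI_hom p (as_space W (k, M)) (W k)"
      using as_space_VI(2)[OF W kM] by simp
    have "q (as_space W (k, M)) (k, id_map M) =
        pull F (as_space W (k, M)) (W k) (id_map M) (q (W k) (k, id_map (carrier (W k))))"
      using under_obj_naturality[OF F as_space_VI(1)[OF W kM] W[OF k] incl k
          VI_hom_id[OF VI_obj_vectorspace[OF W[OF k]]]]
      unfolding compose_id_map[OF incl] .
    then show ?thesis
      unfolding restricted_elt_def prod.case by (rule sym)
  qed
  have "pull F (as_space W (i, U)) (as_space W (j, U')) \<alpha> (q (as_space W (j, U')) (j, id_map U'))
      = q (as_space W (i, U)) (j, \<alpha>)"
    if \<alpha>: "\<alpha> \<in> lin_iso p (as_space W (i, U)) (as_space W (j, U'))"
  proof -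
    have hom: "\<alpha> \<in> VI_hom p (as_space W (i, U)) (as_space W (j, U'))"
      using \<alpha> lin_iso_subset_VI_hom by blast
    have "j \<in> I"
      using y by (simp add: gpd_obj_def)
    then show ?thesis
      using under_obj_naturality[OF F as_space_VI(1)[OF W x] as_space_VI(1)[OF W y] hom, of j "id_map U'"]
        as_space_VI(2)[OF W y] compose_id_map[OF hom]
      by (simp add: carrier_as_space)
  qed
  then show ?thesis
    using x y elt[OF x] elt[OF y] by (auto simp: gpd_of_def)
qed

text \<open>Pulling back along \<open>\<zeta>\<close> turns the pair \<open>(\<alpha>, \<iota>)\<close> on \<open>Im \<zeta>\<close> into \<open>(\<alpha> \<circ> \<zeta>, \<zeta>)\<close>, and pulling back
  along \<open>\<zeta>\<^sup>-\<^sup>1\<close> undoes this; so membership of \<open>\<alpha>\<close> in the groupoid, as described by \<open>gpd_of_iff\<close>, and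
  the equation \<open>q V (i, \<zeta>) = q V (j, \<epsilon>)\<close> imply each other.\<close>

lemma gpd_rel_gpd_of_iff:
  assumes F: "under_obj p I W F q" and W: "\<And>i. i \<in> I \<Longrightarrow> VI_obj p (W i)" and V: "VI_obj p V"
  shows "(z, w) \<in> gpd_rel p I W (gpd_of p I W F q) V \<longleftrightarrow>
    z \<in> ob (hom_sum p I W) V \<and> w \<in> ob (hom_sum p I W) V \<and> q V z = q V w"
proof -
  obtain i \<zeta> j \<epsilon> where zw: "z = (i, \<zeta>)" "w = (j, \<epsilon>)"
    by (cases z, cases w)
  have "(\<exists>\<alpha>\<in>gpd_of p I W F q (i, \<zeta> ` carrier V) (j, \<epsilon> ` carrier V). \<epsilon> = compose (carrier V) \<alpha> \<zeta>)
      \<longleftrightarrow> q V (i, \<zeta>) = q V (j, \<epsilon>)" (is "?L \<longleftrightarrow> ?R")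
    if i: "i \<in> I" and j: "j \<in> I" and \<zeta>: "\<zeta> \<in> VI_hom p V (W i)" and \<epsilon>: "\<epsilon> \<in> VI_hom p V (W j)"
  proof -
    define x y where "x = (i, \<zeta> ` carrier V)" and "y = (j, \<epsilon> ` carrier V)"
    define X Y where "X = as_space W x" and "Y = as_space W y"
    have carrier: "carrier X = \<zeta> ` carrier V" "carrier Y = \<epsilon> ` carrier V"
      by (simp_all add: X_def Y_def x_def y_def as_space_def)
    have xy: "x \<in> gpd_obj p I W" "y \<in> gpd_obj p I W"
      using i j subspace_image_VI_hom[OF \<zeta>] subspace_image_VI_hom[OF \<epsilon>]
      by (simp_all add: x_def y_def gpd_obj_def)
    have X: "VI_obj p X"
      unfolding X_def by (rule as_space_VI(1)[OF W xy(1)])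
    have \<zeta>X: "\<zeta> \<in> lin_iso p V X" and \<epsilon>Y: "\<epsilon> \<in> lin_iso p V Y"
      using lin_iso_corestriction[OF \<zeta>] lin_iso_corestriction[OF \<epsilon>]
      by (simp_all add: X_def Y_def x_def y_def as_space_def)
    have incl: "id_map (carrier X) \<in> VI_hom p X (W i)"
      using as_space_VI(2)[OF W xy(1)] by (simp add: X_def x_def carrier_as_space)
    have mor: "\<alpha> \<in> gpd_of p I W F q x y \<longleftrightarrow>
        \<alpha> \<in> lin_iso p X Y \<and> q X (j, \<alpha>) = q X (i, id_map (carrier X))" for \<alpha>
      unfolding carrier unfolding X_def Y_def x_def y_def
      by (rule gpd_of_iff[OF F W xy[unfolded x_def y_def]])
    have "?L \<longleftrightarrow> (\<exists>\<alpha>\<in>gpd_of p I W F q x y. \<epsilon> = compose (carrier V) \<alpha> \<zeta>)"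
      by (simp add: x_def y_def)
    also have "\<dots> \<longleftrightarrow> ?R"
    proof
      assume "\<exists>\<alpha>\<in>gpd_of p I W F q x y. \<epsilon> = compose (carrier V) \<alpha> \<zeta>"
      then obtain \<alpha> where \<alpha>: "\<alpha> \<in> lin_iso p X Y" "q X (j, \<alpha>) = q X (i, id_map (carrier X))"
        and \<epsilon>_eq: "\<epsilon> = compose (carrier V) \<alpha> \<zeta>"
        using mor by blast
      have \<zeta>': "\<zeta> \<in> VI_hom p V X"
        using \<zeta>X lin_iso_subset_VI_hom by blast
      have \<alpha>W: "\<alpha> \<in> VI_hom p X (W j)"
        using lin_iso_as_space_VI_hom[OF W xy(2)] \<alpha>(1) by (simp add: Y_def y_def)
      have "q V (i, \<zeta>) = pull F V X \<zeta> (q X (i, id_map (carrier X)))"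
        using under_obj_naturality[OF F V X \<zeta>' i incl] unfolding compose_id_map[OF \<zeta>'] .
      also have "\<dots> = q V (j, \<epsilon>)"
        using under_obj_naturality[OF F V X \<zeta>' j \<alpha>W] \<alpha>(2) \<epsilon>_eq by simp
      finally show ?R .
    next
      assume R: ?R
      \<comment> \<open>\<open>\<kappa>\<close> is the inverse of \<open>\<zeta> : V \<rightarrow> X\<close>, so \<open>\<alpha> = \<epsilon> \<circ> \<zeta>\<^sup>-\<^sup>1\<close> is the only candidate.\<close>
      define \<kappa> where "\<kappa> = restrict (inv_into (carrier V) \<zeta>) (carrier X)"
      define \<alpha> where "\<alpha> = compose (carrier X) \<epsilon> \<kappa>"
      have \<kappa>: "\<kappa> \<in> lin_iso p X V"
        unfolding \<kappa>_def by (rule lin_iso_inverse[OF \<zeta>X])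
      then have \<kappa>': "\<kappa> \<in> VI_hom p X V"
        using lin_iso_subset_VI_hom by blast
      have left: "\<kappa> (\<zeta> v) = v" if "v \<in> carrier V" for v
        using that VI_homD(3)[OF \<zeta>] by (simp add: \<kappa>_def carrier)
      have right: "compose (carrier X) \<zeta> \<kappa> = id_map (carrier X)"
        by (auto simp: compose_def \<kappa>_def carrier fun_eq_iff left f_inv_into_f inv_into_into)
      have "\<alpha> ` carrier X = \<epsilon> ` carrier V"
        using \<kappa> by (auto simp: \<alpha>_def compose_def lin_iso_def bij_betw_def image_image[symmetric])
      moreover have "\<alpha> \<in> VI_hom p X (W j)"
        unfolding \<alpha>_def by (rule VI_hom_compose[OF \<kappa>' \<epsilon>])
      ultimately have "\<alpha> \<in> lin_iso p X Y"
        using lin_iso_corestriction[of \<alpha> p X "W j"] by (simp add: Y_def y_def as_space_def)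
      moreover have "q X (j, \<alpha>) = q X (i, id_map (carrier X))"
        using under_obj_naturality[OF F X V \<kappa>' j \<epsilon>] under_obj_naturality[OF F X V \<kappa>' i \<zeta>] R right
        by (simp add: \<alpha>_def)
      moreover have "\<epsilon> = compose (carrier V) \<alpha> \<zeta>"
        using VI_homD(1)[OF \<epsilon>] left
        by (auto simp: \<alpha>_def compose_def carrier fun_eq_iff extensional_def)
      ultimately show "\<exists>\<alpha>\<in>gpd_of p I W F q x y. \<epsilon> = compose (carrier V) \<alpha> \<zeta>"
        using mor by blast
    qed
    finally show ?thesis .
  qed
  then show ?thesis
    unfolding zw by (auto simp: gpd_rel_def mem_hom_sum)
qed

section \<open>From a groupoid to its quotient and back\<close>

lemma groupoid_lin_iso:
  assumes "is_groupoid p I W \<G>" and "x \<in> gpd_obj p I W" and "y \<in> gpd_obj p I W"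
  shows "\<G> x y \<subseteq> lin_iso p (as_space W x) (as_space W y)"
proof -
  have "\<forall>x\<in>gpd_obj p I W. \<forall>y\<in>gpd_obj p I W. \<G> x y \<subseteq> lin_iso p (as_space W x) (as_space W y)"
    using assms(1) unfolding is_groupoid_def by (elim conjE)
  then show ?thesis
    using assms(2,3) by blast
qed

lemma groupoid_id:
  assumes "is_groupoid p I W \<G>" and "(i, U) \<in> gpd_obj p I W"
  shows "id_map U \<in> \<G> (i, U) (i, U)"
proof -
  have "\<forall>x\<in>gpd_obj p I W. id_map (snd x) \<in> \<G> x x"
    using assms(1) unfolding is_groupoid_def by (elim conjE)
  from bspec[OF this assms(2)] show ?thesis
    unfolding snd_conv .
qed

lemma groupoid_compose:
  assumes "is_groupoid p I W \<G>"
    and "(i, U) \<in> gpd_obj p I W" and "y \<in> gpd_obj p I W" and "z \<in> gpd_obj p I W"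
    and "\<alpha> \<in> \<G> (i, U) y" and "\<beta> \<in> \<G> y z"
  shows "compose U \<beta> \<alpha> \<in> \<G> (i, U) z"
proof -
  have "\<forall>x\<in>gpd_obj p I W. \<forall>y\<in>gpd_obj p I W. \<forall>z\<in>gpd_obj p I W.
      \<forall>\<alpha>\<in>\<G> x y. \<forall>\<beta>\<in>\<G> y z. compose (snd x) \<beta> \<alpha> \<in> \<G> x z"
    using assms(1) unfolding is_groupoid_def by (elim conjE)
  from this[rule_format, OF assms(2-6)] show ?thesis
    unfolding snd_conv .
qed

lemma groupoid_inverse:
  assumes "is_groupoid p I W \<G>"
    and "(i, U) \<in> gpd_obj p I W" and "(j, U') \<in> gpd_obj p I W" and "\<alpha> \<in> \<G> (i, U) (j, U')"
  shows "restrict (inv_into U \<alpha>) U' \<in> \<G> (j, U') (i, U)"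
proof -
  have "\<forall>x\<in>gpd_obj p I W. \<forall>y\<in>gpd_obj p I W.
      \<forall>\<alpha>\<in>\<G> x y. restrict (inv_into (snd x) \<alpha>) (snd y) \<in> \<G> y x"
    using assms(1) unfolding is_groupoid_def by (elim conjE)
  from this[rule_format, OF assms(2-4)] show ?thesis
    unfolding snd_conv .
qed

text \<open>Identities, inverses and composites of \<open>\<G>\<close> witness reflexivity, symmetry and
  transitivity.\<close>

lemma groupoid_rel_equiv:
  assumes G: "is_groupoid p I W \<G>"
  shows "equiv (ob (hom_sum p I W) V) (gpd_rel p I W \<G> V)"
proof (rule equivI)
  have obj: "(i, \<zeta> ` carrier V) \<in> gpd_obj p I W" if "i \<in> I" "\<zeta> \<in> VI_hom p V (W i)" for i \<zeta>
    using that subspace_image_VI_hom by (auto simp: gpd_obj_def)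
  show "gpd_rel p I W \<G> V \<subseteq> ob (hom_sum p I W) V \<times> ob (hom_sum p I W) V"
    by (auto simp: gpd_rel_def)
  show "refl_on (ob (hom_sum p I W) V) (gpd_rel p I W \<G> V)"
  proof (rule refl_onI)
    fix z assume z: "z \<in> ob (hom_sum p I W) V"
    obtain i \<zeta> where z_eq: "z = (i, \<zeta>)"
      by (cases z)
    have \<zeta>: "i \<in> I" "\<zeta> \<in> VI_hom p V (W i)"
      using z by (simp_all add: z_eq mem_hom_sum)
    have "id_map (\<zeta> ` carrier V) \<in> \<G> (i, \<zeta> ` carrier V) (i, \<zeta> ` carrier V)"
      by (rule groupoid_id[OF G obj[OF \<zeta>]])
    moreover have "\<zeta> = compose (carrier V) (id_map (\<zeta> ` carrier V)) \<zeta>"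
      using VI_homD(1)[OF \<zeta>(2)] by (auto simp: compose_def fun_eq_iff extensional_def)
    ultimately show "(z, z) \<in> gpd_rel p I W \<G> V"
      using z unfolding gpd_rel_def z_eq by blast
  qed
  show "sym (gpd_rel p I W \<G> V)"
  proof (rule symI)
    fix z w assume zw: "(z, w) \<in> gpd_rel p I W \<G> V"
    obtain i \<zeta> j \<epsilon> where eqs: "z = (i, \<zeta>)" "w = (j, \<epsilon>)"
      by (cases z, cases w)
    obtain \<alpha> where \<zeta>: "i \<in> I" "\<zeta> \<in> VI_hom p V (W i)" and \<epsilon>: "j \<in> I" "\<epsilon> \<in> VI_hom p V (W j)"
      and \<alpha>: "\<alpha> \<in> \<G> (i, \<zeta> ` carrier V) (j, \<epsilon> ` carrier V)" and \<epsilon>_eq: "\<epsilon> = compose (carrier V) \<alpha> \<zeta>"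
      using zw by (auto simp: gpd_rel_def eqs mem_hom_sum)
    define \<kappa> where "\<kappa> = restrict (inv_into (\<zeta> ` carrier V) \<alpha>) (\<epsilon> ` carrier V)"
    have "\<kappa> \<in> \<G> (j, \<epsilon> ` carrier V) (i, \<zeta> ` carrier V)"
      unfolding \<kappa>_def by (rule groupoid_inverse[OF G obj[OF \<zeta>] obj[OF \<epsilon>] \<alpha>])
    moreover have "inj_on \<alpha> (\<zeta> ` carrier V)"
      using groupoid_lin_iso[OF G obj[OF \<zeta>] obj[OF \<epsilon>]] \<alpha>
      by (auto simp: lin_iso_def carrier_as_space bij_betw_def)
    then have "\<zeta> = compose (carrier V) \<kappa> \<epsilon>"
      using VI_homD(1)[OF \<zeta>(2)]
      by (auto simp: \<epsilon>_eq \<kappa>_def compose_def fun_eq_iff extensional_def)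
    ultimately show "(w, z) \<in> gpd_rel p I W \<G> V"
      using \<zeta> \<epsilon> unfolding gpd_rel_def eqs by (auto simp: mem_hom_sum)
  qed
  show "trans (gpd_rel p I W \<G> V)"
  proof (rule transI)
    fix z w u assume zw: "(z, w) \<in> gpd_rel p I W \<G> V" and wu: "(w, u) \<in> gpd_rel p I W \<G> V"
    obtain i \<zeta> j \<epsilon> k \<delta> where eqs: "z = (i, \<zeta>)" "w = (j, \<epsilon>)" "u = (k, \<delta>)"
      by (cases z, cases w, cases u)
    obtain \<alpha> \<beta> where \<zeta>: "i \<in> I" "\<zeta> \<in> VI_hom p V (W i)" and \<epsilon>: "j \<in> I" "\<epsilon> \<in> VI_hom p V (W j)"
      and \<delta>: "k \<in> I" "\<delta> \<in> VI_hom p V (W k)"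
      and \<alpha>: "\<alpha> \<in> \<G> (i, \<zeta> ` carrier V) (j, \<epsilon> ` carrier V)" "\<epsilon> = compose (carrier V) \<alpha> \<zeta>"
      and \<beta>: "\<beta> \<in> \<G> (j, \<epsilon> ` carrier V) (k, \<delta> ` carrier V)" "\<delta> = compose (carrier V) \<beta> \<epsilon>"
      using zw wu by (auto simp: gpd_rel_def eqs mem_hom_sum)
    have "compose (\<zeta> ` carrier V) \<beta> \<alpha> \<in> \<G> (i, \<zeta> ` carrier V) (k, \<delta> ` carrier V)"
      by (rule groupoid_compose[OF G obj[OF \<zeta>] obj[OF \<epsilon>] obj[OF \<delta>] \<alpha>(1) \<beta>(1)])
    moreover have "\<delta> = compose (carrier V) (compose (\<zeta> ` carrier V) \<beta> \<alpha>) \<zeta>"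
      unfolding \<beta>(2) \<alpha>(2) by (auto simp: compose_def fun_eq_iff)
    ultimately show "(z, u) \<in> gpd_rel p I W \<G> V"
      using \<zeta> \<delta> unfolding gpd_rel_def eqs by (auto simp: mem_hom_sum)
  qed
qed

lemma restriction_propertyD:
  assumes "restriction_property p I W \<G>"
    and "(i, U) \<in> gpd_obj p I W" and "(j, U') \<in> gpd_obj p I W" and "\<alpha> \<in> \<G> (i, U) (j, U')"
    and "VectorSpace.subspace (Fp p) M (W i)" and "M \<subseteq> U"
  shows "restrict \<alpha> M \<in> \<G> (i, M) (j, \<alpha> ` M)"
  using bspec[OF bspec[OF assms(1)[unfolded restriction_property_def] assms(2), unfolded prod.case]
      assms(3), unfolded prod.case] assms(4-6)
  by blast

text \<open>If \<open>\<alpha>\<close> carries \<open>\<zeta>\<close> to \<open>\<epsilon>\<close>, then its restriction to the smaller subspace \<open>Im (\<zeta> \<circ> \<beta>)\<close>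
  carries \<open>\<zeta> \<circ> \<beta>\<close> to \<open>\<epsilon> \<circ> \<beta>\<close>.\<close>

lemma groupoid_rel_stable:
  assumes R: "restriction_property p I W \<G>"
    and \<beta>: "\<beta> \<in> VI_hom p U V" and zw: "(z, w) \<in> gpd_rel p I W \<G> V"
  shows "(pull (hom_sum p I W) U V \<beta> z, pull (hom_sum p I W) U V \<beta> w) \<in> gpd_rel p I W \<G> U"
proof -
  obtain i \<zeta> j \<epsilon> where eqs: "z = (i, \<zeta>)" "w = (j, \<epsilon>)"
    by (cases z, cases w)
  obtain \<alpha> where \<zeta>: "i \<in> I" "\<zeta> \<in> VI_hom p V (W i)" and \<epsilon>: "j \<in> I" "\<epsilon> \<in> VI_hom p V (W j)"
    and \<alpha>: "\<alpha> \<in> \<G> (i, \<zeta> ` carrier V) (j, \<epsilon> ` carrier V)" and \<epsilon>_eq: "\<epsilon> = compose (carrier V) \<alpha> \<zeta>"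
    using zw by (auto simp: gpd_rel_def eqs mem_hom_sum)
  define \<zeta>' \<epsilon>' where "\<zeta>' = compose (carrier U) \<zeta> \<beta>" and "\<epsilon>' = compose (carrier U) \<epsilon> \<beta>"
  have \<zeta>': "\<zeta>' \<in> VI_hom p U (W i)" and \<epsilon>': "\<epsilon>' \<in> VI_hom p U (W j)"
    unfolding \<zeta>'_def \<epsilon>'_def using VI_hom_compose[OF \<beta>] \<zeta> \<epsilon> by auto
  let ?M = "\<zeta>' ` carrier U"
  have obj: "(i, \<zeta> ` carrier V) \<in> gpd_obj p I W" "(j, \<epsilon> ` carrier V) \<in> gpd_obj p I W"
    using \<zeta> \<epsilon> subspace_image_VI_hom by (auto simp: gpd_obj_def)
  have sub: "?M \<subseteq> \<zeta> ` carrier V"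
    using VI_homD(4)[OF \<beta>] by (auto simp: \<zeta>'_def compose_def)
  have pointwise: "\<epsilon>' u = \<alpha> (\<zeta>' u)" if "u \<in> carrier U" for u
    using that VI_homD(4)[OF \<beta> that] by (simp add: \<zeta>'_def \<epsilon>'_def \<epsilon>_eq compose_def)
  then have image: "\<alpha> ` ?M = \<epsilon>' ` carrier U"
    by (simp add: image_image)
  have "restrict \<alpha> ?M \<in> \<G> (i, ?M) (j, \<epsilon>' ` carrier U)"
    using restriction_propertyD[OF R obj \<alpha> subspace_image_VI_hom[OF \<zeta>'] sub] unfolding image .
  moreover have "\<epsilon>' = compose (carrier U) (restrict \<alpha> ?M) \<zeta>'"
    using VI_homD(1)[OF \<epsilon>'] pointwise by (auto simp: compose_def fun_eq_iff extensional_def)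
  ultimately have "((i, \<zeta>'), (j, \<epsilon>')) \<in> gpd_rel p I W \<G> U"
    using \<zeta>(1) \<epsilon>(1) \<zeta>' \<epsilon>' unfolding gpd_rel_def by (auto simp: mem_hom_sum)
  then show ?thesis
    by (simp add: eqs pull_hom_sum \<zeta>'_def \<epsilon>'_def)
qed

text \<open>By \<open>gpd_of_iff\<close>, \<open>\<alpha> : U \<rightarrow> U'\<close> is a morphism on the left if and only if some \<open>\<beta> \<in> \<G>\<close>
  carries the inclusion of \<open>U\<close> to \<open>\<alpha>\<close>. Such a \<open>\<beta>\<close> starts at \<open>U\<close> and agrees with \<open>\<alpha>\<close> there, so it is
  \<open>\<alpha>\<close>.\<close>

lemma gpd_of_quot:
  assumes W: "\<And>i. i \<in> I \<Longrightarrow> VI_obj p (W i)"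
    and G: "is_groupoid p I W \<G>" and Q: "under_obj p I W (quot p I W \<G>) (quot_map p I W \<G>)"
  shows "gpd_of p I W (quot p I W \<G>) (quot_map p I W \<G>) = \<G>"
proof (intro ext)
  fix x y
  show "gpd_of p I W (quot p I W \<G>) (quot_map p I W \<G>) x y = \<G> x y"
  proof (cases "x \<in> gpd_obj p I W \<and> y \<in> gpd_obj p I W")
    case False
    have "\<forall>x y. \<not> (x \<in> gpd_obj p I W \<and> y \<in> gpd_obj p I W) \<longrightarrow> \<G> x y = {}"
      using G unfolding is_groupoid_def by (elim conjE)
    then have "\<G> x y = {}"
      using False by blast
    moreover have "gpd_of p I W (quot p I W \<G>) (quot_map p I W \<G>) x y = {}"
      using False unfolding gpd_of_def by blast
    ultimately show ?thesis
      by simp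
  next
    case True
    obtain i U j U' where eqs: "x = (i, U)" "y = (j, U')"
      by (cases x, cases y)
    define X Y where "X = as_space W x" and "Y = as_space W y"
    have carrier: "carrier X = U" "carrier Y = U'"
      by (simp_all add: X_def Y_def eqs as_space_def)
    have ij: "i \<in> I" "j \<in> I"
      using True by (auto simp: eqs gpd_obj_def)
    have incl: "id_map U \<in> VI_hom p X (W i)"
      using as_space_VI(2)[OF W True[THEN conjunct1]] by (simp add: X_def eqs)
    have sub: "\<G> x y \<subseteq> lin_iso p X Y"
      using groupoid_lin_iso[OF G] True unfolding X_def Y_def by blast
    have "\<alpha> \<in> gpd_of p I W (quot p I W \<G>) (quot_map p I W \<G>) x y \<longleftrightarrow> \<alpha> \<in> \<G> x y"
      if \<alpha>: "\<alpha> \<in> lin_iso p X Y" for \<alpha>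
    proof -
      have \<alpha>W: "\<alpha> \<in> VI_hom p X (W j)"
        using lin_iso_as_space_VI_hom[OF W True[THEN conjunct2]] \<alpha> by (simp add: Y_def eqs)
      have img: "\<alpha> ` U = U'"
        using \<alpha> by (simp add: lin_iso_def bij_betw_def carrier)
      have ext: "compose U \<beta> (id_map U) = \<beta>" if "\<beta> \<in> \<G> x y" for \<beta>
        using sub that carrier by (auto simp: lin_iso_def compose_def fun_eq_iff extensional_def)
      have "\<alpha> \<in> gpd_of p I W (quot p I W \<G>) (quot_map p I W \<G>) x y \<longleftrightarrow>
          quot_map p I W \<G> X (i, id_map U) = quot_map p I W \<G> X (j, \<alpha>)"
        using gpd_of_iff[OF Q W, of i U j U' \<alpha>] True \<alpha> by (auto simp: eqs X_def Y_def)
      also have "\<dots> \<longleftrightarrow> ((i, id_map U), (j, \<alpha>)) \<in> gpd_rel p I W \<G> X"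
        using ij incl \<alpha>W by (intro quot_map_eq_iff groupoid_rel_equiv[OF G]) (simp_all add: mem_hom_sum)
      also have "\<dots> \<longleftrightarrow> (\<exists>\<beta>\<in>\<G> x y. \<alpha> = compose U \<beta> (id_map U))"
        using ij incl \<alpha>W img by (simp add: gpd_rel_def mem_hom_sum carrier eqs)
      also have "\<dots> \<longleftrightarrow> \<alpha> \<in> \<G> x y"
        using ext by force
      finally show ?thesis .
    qed
    moreover have "gpd_of p I W (quot p I W \<G>) (quot_map p I W \<G>) x y \<subseteq> lin_iso p X Y"
      by (auto simp: gpd_of_def X_def Y_def)
    ultimately show ?thesis
      using sub by blast
  qed
qed

theorem theorem5p17:
  fixes p :: nat and I :: "'i set" and W :: "'i \<Rightarrow> 'v space"
  assumes "prime p"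
    and "\<And>i. i \<in> I \<Longrightarrow> VI_obj p (W i)"
  shows "(\<forall>\<G>. is_groupoid p I W \<G> \<and> restriction_property p I W \<G> \<longrightarrow>
            under_obj p I W (quot p I W \<G>) (quot_map p I W \<G>) \<and>
            gpd_of p I W (quot p I W \<G>) (quot_map p I W \<G>) = \<G>) \<and>
         (\<forall>(F :: ('v, 's) presheaf) q. under_obj p I W F q \<longrightarrow>
            under_isomorphic p I W F q
              (quot p I W (gpd_of p I W F q)) (quot_map p I W (gpd_of p I W F q)))"
proof (intro conjI allI impI)
  fix \<G> assume G: "is_groupoid p I W \<G> \<and> restriction_property p I W \<G>"
  then show Q: "under_obj p I W (quot p I W \<G>) (quot_map p I W \<G>)"
    by (intro under_obj_quot) (auto intro: groupoid_rel_equiv groupoid_rel_stable)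
  show "gpd_of p I W (quot p I W \<G>) (quot_map p I W \<G>) = \<G>"
    using G by (intro gpd_of_quot assms(2) Q) auto
next
  fix F :: "('v, 's) presheaf" and q
  assume F: "under_obj p I W F q"
  note ker = gpd_rel_gpd_of_iff[OF F assms(2)]
  \<comment> \<open>As the relation is the kernel of a natural transformation, it is a stable equivalence relation.\<close>
  have eqv: "equiv (ob (hom_sum p I W) V) (gpd_rel p I W (gpd_of p I W F q) V)"
    if "VI_obj p V" for V
    by (auto intro!: equivI refl_onI symI transI simp: ker[OF _ that])
  have "under_obj p I W (quot p I W (gpd_of p I W F q)) (quot_map p I W (gpd_of p I W F q))"
  proof (rule under_obj_quot[OF eqv])
    fix U V \<alpha> z w
    assume UV: "VI_obj p U" "VI_obj p V" and \<alpha>: "\<alpha> \<in> VI_hom p U V"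
      and zw: "(z, w) \<in> gpd_rel p I W (gpd_of p I W F q) V"
    have "q U (pull (hom_sum p I W) U V \<alpha> z) = q U (pull (hom_sum p I W) U V \<alpha> w)"
      using under_obj_pull[OF F UV \<alpha>] zw ker[OF _ UV(2)] by simp
    then show "(pull (hom_sum p I W) U V \<alpha> z, pull (hom_sum p I W) U V \<alpha> w)
        \<in> gpd_rel p I W (gpd_of p I W F q) U"
      using zw \<alpha> UV by (simp add: ker pull_hom_sum_closed)
  qed
  then show "under_isomorphic p I W F q
      (quot p I W (gpd_of p I W F q)) (quot_map p I W (gpd_of p I W F q))"
    by (rule under_isomorphic_if_kernel_eq[OF F]) (simp add: quot_map_eq_iff[OF eqv] ker)
qed

end
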